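(* Let $c$ be a fixed real number with $0<c\le 1$, and for each $n$ let $L=cn$ (rounded to an integer). Let $A$ be chosen uniformly at random from the set $M_{L,n,3}$ of Boolean $L\times n$ matrices with exactly $3$ ones in each row, and let $P_{(L)}$ be the probability that $A$ has rank $L$ over $GF(2)$ (maximal rank). Then, as $n\to\infty$, $$P_{(L)}\le 1-\frac{e^{-3c}+3c\,e^{-6c}-c\,e^{-9c}-1+c}{c}+o(1).$$ *)

theory Defs
  imports
    "HOL-Probability.Probability"
    "HOL-Library.Z2"
    "Jordan_Normal_Form.DL_Rank"
begin

text \<open>
  Boolean matrices are matrices over the type \<open>bit\<close>, which is the two-element field, so that
  \<open>vec_space.rank L\<close> (whose parameter is the number of rows) is the rank over GF(2).
\<close>

definition bool_mats :: "nat \<Rightarrow> nat \<Rightarrow> nat \<Rightarrow> bit mat set" where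
  "bool_mats L n k =
     {A \<in> carrier_mat L n. \<forall>i<L. card {j. j < n \<and> A $$ (i, j) = 1} = k}"

text \<open>
  \<open>bool_mats L n 3\<close> is finite, and it is nonempty whenever \<open>n \<ge> 3\<close>; only in the
  nonempty case is \<open>pmf_of_set\<close> the uniform distribution.
\<close>

definition max_rank_prob :: "nat \<Rightarrow> nat \<Rightarrow> real" where
  "max_rank_prob L n =
     measure_pmf.prob (pmf_of_set (bool_mats L n 3)) {A. vec_space.rank L A = L}"

end

theory Submission
  imports Defs "HOL-Real_Asymp.Real_Asymp"
begin

text \<open>
  A first moment argument on the rank deficiency. The rank of a matrix is at most the number of its
  distinct nonzero columns. The columns with a single one, in row \<open>i\<close>, all equal the \<open>i\<close>-th unit
  vector; if there are \<open>u\<^sub>i\<close> of them, then \<open>rank A \<le> n - D\<close>, where \<open>D\<close> is the number of zero columns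
  plus the sum of all \<open>max 0 (u\<^sub>i - 1)\<close>. Hence \<open>L - n + D\<close> is at most \<open>0\<close> if \<open>A\<close> has rank \<open>L\<close> and at
  most \<open>L\<close> otherwise, so the probability of rank less than \<open>L\<close> is at least \<open>(L - n + E[D]) / L\<close>.
  As \<open>u\<^sub>i \<le> 3\<close>, \<open>max 0 (u\<^sub>i - 1)\<close> is \<open>u\<^sub>i choose 2\<close> minus \<open>u\<^sub>i choose 3\<close>, which makes
  \<open>E[D]\<close> explicit.
\<close>

section \<open>Matrices as families of row supports\<close>

text \<open>\<open>PiE\<close> fixes the values outside \<open>{..<L}\<close>, so each matrix has
  exactly one family, and the product form lets the rows be counted independently.\<close>

definition row_supports :: "nat \<Rightarrow> nat \<Rightarrow> nat \<Rightarrow> (nat \<Rightarrow> nat set) set" where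
  "row_supports L n k = PiE {..<L} (\<lambda>_. {S. S \<subseteq> {..<n} \<and> card S = k})"

definition incidence_mat :: "nat \<Rightarrow> nat \<Rightarrow> (nat \<Rightarrow> nat set) \<Rightarrow> bit mat" where
  "incidence_mat L n f = mat L n (\<lambda>(i, j). if j \<in> f i then 1 else 0)"

definition zero_cols :: "nat \<Rightarrow> nat \<Rightarrow> (nat \<Rightarrow> nat set) \<Rightarrow> nat set" where
  "zero_cols L n f = {j. j < n \<and> (\<forall>i<L. j \<notin> f i)}"

definition private_cols :: "nat \<Rightarrow> (nat \<Rightarrow> nat set) \<Rightarrow> nat \<Rightarrow> nat set" where
  "private_cols L f i = {j \<in> f i. \<forall>k<L. k \<noteq> i \<longrightarrow> j \<notin> f k}"

text \<open>Truncated subtraction: a row without private columns contributes \<open>0\<close>.\<close>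

definition redundancy :: "nat \<Rightarrow> nat \<Rightarrow> (nat \<Rightarrow> nat set) \<Rightarrow> nat" where
  "redundancy L n f = card (zero_cols L n f) + (\<Sum>i<L. card (private_cols L f i) - 1)"

lemma row_supportsD:
  assumes "f \<in> row_supports L n k" "i < L"
  shows "f i \<subseteq> {..<n}" "card (f i) = k" "finite (f i)"
  using assms by (auto simp: row_supports_def PiE_iff intro: finite_subset[of _ "{..<n}"])

lemma finite_row_supports: "finite (row_supports L n k)"
  unfolding row_supports_def by (intro finite_PiE) auto

lemma card_row_supports: "card (row_supports L n k) = (n choose k) ^ L"
  unfolding row_supports_def by (simp add: card_PiE n_subsets)

text \<open>The inverse reads off where each row has its ones. Nothing is lost, because an entry of
  type \<open>bit\<close> other than \<open>1\<close> is \<open>0\<close>.\<close>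

lemma bij_betw_incidence_mat:
  "bij_betw (incidence_mat L n) (row_supports L n k) (bool_mats L n k)"
proof (rule bij_betw_byWitness
    [where f' = "\<lambda>A. restrict (\<lambda>i. {j. j < n \<and> A $$ (i, j) = 1}) {..<L}"])
  show "\<forall>f\<in>row_supports L n k.
      restrict (\<lambda>i. {j. j < n \<and> incidence_mat L n f $$ (i, j) = 1}) {..<L} = f"
  proof
    fix f assume f: "f \<in> row_supports L n k"
    show "restrict (\<lambda>i. {j. j < n \<and> incidence_mat L n f $$ (i, j) = 1}) {..<L} = f"
    proof
      fix i
      show "restrict (\<lambda>i. {j. j < n \<and> incidence_mat L n f $$ (i, j) = 1}) {..<L} i = f i"
      proof (cases "i < L")
        case True
        then show ?thesis
          using row_supportsD(1)[OF f True] by (auto simp: incidence_mat_def split: if_splits)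
      next
        case False
        then show ?thesis
          using f by (auto simp: row_supports_def PiE_iff extensional_def)
      qed
    qed
  qed
  show "\<forall>A\<in>bool_mats L n k.
      incidence_mat L n (restrict (\<lambda>i. {j. j < n \<and> A $$ (i, j) = 1}) {..<L}) = A"
    by (auto simp: incidence_mat_def bool_mats_def intro!: eq_matI)
  show "incidence_mat L n ` row_supports L n k \<subseteq> bool_mats L n k"
  proof
    fix A assume "A \<in> incidence_mat L n ` row_supports L n k"
    then obtain f where f: "f \<in> row_supports L n k" and A: "A = incidence_mat L n f"
      by auto
    have "card {j. j < n \<and> A $$ (i, j) = 1} = k" if "i < L" for i
    proof -
      have "{j. j < n \<and> A $$ (i, j) = 1} = f i"
        using row_supportsD(1)[OF f that] that by (auto simp: A incidence_mat_def split: if_splits)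
      then show ?thesis
        using row_supportsD(2)[OF f that] by simp
    qed
    then show "A \<in> bool_mats L n k"
      by (auto simp: bool_mats_def A incidence_mat_def)
  qed
  show "(\<lambda>A. restrict (\<lambda>i. {j. j < n \<and> A $$ (i, j) = 1}) {..<L}) ` bool_mats L n k
      \<subseteq> row_supports L n k"
    by (auto simp: row_supports_def bool_mats_def)
qed

text \<open>The bijection turns the probability into a count of supports; \<open>3 \<le> n\<close>
  makes the set of matrices nonempty, so that \<open>pmf_of_set\<close> is uniform.\<close>

lemma max_rank_prob_eq:
  assumes "3 \<le> n"
  shows "max_rank_prob L n =
    card {f \<in> row_supports L n 3. vec_space.rank L (incidence_mat L n f) = L} /
      (n choose 3) ^ L"
proof -
  note bij = bij_betw_incidence_mat[of L n 3]
  have card: "card (bool_mats L n 3) = (n choose 3) ^ L"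
    using bij_betw_same_card[OF bij] card_row_supports[of L n 3] by simp
  then have "card (bool_mats L n 3) > 0"
    using assms by (simp add: zero_less_binomial_iff)
  then have fin: "finite (bool_mats L n 3)" "bool_mats L n 3 \<noteq> {}"
    using card_gt_0_iff by blast+
  have "bool_mats L n 3 \<inter> {A. vec_space.rank L A = L} =
      incidence_mat L n ` {f \<in> row_supports L n 3. vec_space.rank L (incidence_mat L n f) = L}"
    using bij_betw_imp_surj_on[OF bij] by auto
  moreover have "inj_on (incidence_mat L n)
      {f \<in> row_supports L n 3. vec_space.rank L (incidence_mat L n f) = L}"
    by (rule inj_on_subset[OF bij_betw_imp_inj_on[OF bij]]) auto
  ultimately show ?thesis
    using fin card by (simp add: max_rank_prob_def measure_pmf_of_set card_image)
qed

section \<open>Rank and redundant columns\<close>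

text \<open>The rank is the size of a maximal linearly independent subset of
  \<open>set (cols A)\<close>, where equal columns count once; such a subset cannot contain the zero
  vector.\<close>

lemma (in vec_space) rank_le_card_nonzero_cols:
  assumes "A \<in> carrier_mat n nc"
  shows "rank A \<le> card (set (cols A) - {0\<^sub>v n})"
proof -
  obtain S where S: "maximal S (\<lambda>T. T \<subseteq> set (cols A) \<and> lin_indpt T)"
    using maximal_exists[of "(\<lambda>T. T \<subseteq> set (cols A) \<and> lin_indpt T)" "card (set (cols A))" "{}"]
    by (meson List.finite_set card_mono empty_iff empty_subsetI finite_lin_indpt2 rev_finite_subset)
  then have "S \<subseteq> set (cols A)" "lin_indpt S"
    by (auto simp: maximal_def)
  moreover from this have "0\<^sub>v n \<notin> S"
  proof -
    have "(UNIV :: 'a set) \<noteq> {0}"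
      using one_neq_zero by (metis UNIV_I singletonD)
    moreover have "S \<subseteq> carrier_vec n"
      using \<open>S \<subseteq> set (cols A)\<close> cols_dim[of A] assms by auto
    ultimately show ?thesis
      using zero_nin_lin_indpt[of S] \<open>lin_indpt S\<close> by auto
  qed
  ultimately have "card S \<le> card (set (cols A) - {0\<^sub>v n})"
    by (intro card_mono) auto
  then show ?thesis
    using rank_card_indpt[OF assms S] by simp
qed

text \<open>The columns split into zero columns, the private columns of each row, and the rest.
  These give no nonzero vector, at most one vector per row, and at most one vector per column,
  respectively.\<close>

lemma card_nonzero_cols_add_redundancy_le:
  assumes f: "f \<in> row_supports L n k"
  shows "card (set (cols (incidence_mat L n f)) - {0\<^sub>v L}) + redundancy L n f \<le> n"
proof -
  define g where "g = col (incidence_mat L n f)"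
  define Z where "Z = zero_cols L n f"
  define U where "U = private_cols L f"
  \<comment> \<open>\<open>R\<close> consists of the columns with at least two ones; coincidences
    among them are ignored.\<close>
  define R where "R = {..<n} - Z - (\<Union>i<L. U i)"
  have g: "g j = vec L (\<lambda>i. if j \<in> f i then 1 else 0)" if "j < n" for j
    using that by (auto simp: g_def incidence_mat_def)
  have fin: "finite R" "finite Z"
    by (auto simp: R_def Z_def zero_cols_def)
  have U_sub: "U i \<subseteq> {..<n}" and finU: "finite (U i)" if "i < L" for i
    using row_supportsD[OF f that] by (auto simp: U_def private_cols_def)
  have disj: "U i \<inter> U j = {}" if "i < L" "j < L" "i \<noteq> j" for i j
    using that by (auto simp: U_def private_cols_def)
  have ZU: "Z \<inter> (\<Union>i<L. U i) = {}"
    by (auto simp: U_def Z_def private_cols_def zero_cols_def)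
  have "{..<n} = (Z \<union> R) \<union> (\<Union>i<L. U i)"
    using U_sub by (fastforce simp: R_def Z_def zero_cols_def)
  then have "n = card ((Z \<union> R) \<union> (\<Union>i<L. U i))"
    by (metis card_lessThan)
  also have "\<dots> = card (Z \<union> R) + card (\<Union>i<L. U i)"
    using fin finU ZU by (intro card_Un_disjoint) (auto simp: R_def)
  also have "card (Z \<union> R) = card Z + card R"
    using fin by (intro card_Un_disjoint) (auto simp: R_def)
  also have "card (\<Union>i<L. U i) = (\<Sum>i<L. card (U i))"
    using finU disj by (intro card_UN_disjoint) auto
  finally have n: "n = card Z + card R + (\<Sum>i<L. card (U i))" .
  have U_col: "g ` U i \<subseteq> {unit_vec L i}" if "i < L" for i
  proof
    fix v assume "v \<in> g ` U i"
    then obtain j where j: "j \<in> U i" "v = g j" by auto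
    then have "j \<in> f l \<longleftrightarrow> l = i" if "l < L" for l
      using that by (auto simp: U_def private_cols_def)
    then have "v = unit_vec L i"
      using U_sub[OF that] g[of j] j by (auto simp: unit_vec_def intro!: eq_vecI)
    then show "v \<in> {unit_vec L i}" by simp
  qed
  \<comment> \<open>For empty \<open>U i\<close> both summands on the left are \<open>0\<close> by
    truncation; otherwise the image has at most one element and the subtraction is exact.\<close>
  have U_card: "card (g ` U i) + (card (U i) - 1) \<le> card (U i)" if "i < L" for i
  proof (cases "U i = {}")
    case False
    then have "card (U i) > 0"
      using finU[OF that] by (simp add: card_gt_0_iff)
    moreover have "card (g ` U i) \<le> 1"
      using card_mono[OF _ U_col[OF that]] by simp
    ultimately show ?thesis by simp
  qed simp
  have zero: "g j = 0\<^sub>v L" if "j \<in> Z" for j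
    using that g[of j] by (auto simp: Z_def zero_cols_def zero_vec_def)
  have "set (cols (incidence_mat L n f)) = g ` {..<n}"
    by (auto simp: cols_def g_def incidence_mat_def)
  then have "set (cols (incidence_mat L n f)) - {0\<^sub>v L} \<subseteq> g ` R \<union> (\<Union>i<L. g ` U i)"
  proof -
    have "g j \<in> g ` R \<union> (\<Union>i<L. g ` U i)" if "j < n" "g j \<noteq> 0\<^sub>v L" for j
      using that zero[of j] by (cases "j \<in> R") (auto simp: R_def)
    then show ?thesis
      unfolding \<open>set (cols (incidence_mat L n f)) = g ` {..<n}\<close> by blast
  qed
  then have "card (set (cols (incidence_mat L n f)) - {0\<^sub>v L}) \<le> card (g ` R \<union> (\<Union>i<L. g ` U i))"
    using fin finU by (intro card_mono) auto
  also have "\<dots> \<le> card (g ` R) + card (\<Union>i<L. g ` U i)"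
    by (rule card_Un_le)
  also have "\<dots> \<le> card R + (\<Sum>i<L. card (g ` U i))"
    using fin by (intro add_mono card_image_le card_UN_le) auto
  finally have "card (set (cols (incidence_mat L n f)) - {0\<^sub>v L}) + redundancy L n f \<le>
      card Z + card R + (\<Sum>i<L. card (g ` U i) + (card (U i) - 1))"
    by (simp add: redundancy_def Z_def U_def sum.distrib)
  also have "\<dots> \<le> n"
    using U_card by (subst n) (intro add_mono sum_mono, auto)
  finally show ?thesis .
qed

section \<open>Counting zero and private columns\<close>

text \<open>Deleting \<open>X\<close> from \<open>S\<close> leaves an arbitrary subset of
  \<open>N - X\<close> of size \<open>k - card X\<close>.\<close>

lemma card_supersets:
  assumes "finite N" "X \<subseteq> N" "card X \<le> k"
  shows "card {S. S \<subseteq> N \<and> card S = k \<and> X \<subseteq> S} = (card N - card X) choose (k - card X)"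
proof -
  have finX: "finite X"
    using assms finite_subset by blast
  have "bij_betw (\<lambda>B. B \<union> X) {B. B \<subseteq> N - X \<and> card B = k - card X}
      {S. S \<subseteq> N \<and> card S = k \<and> X \<subseteq> S}"
  proof (rule bij_betw_byWitness[where f' = "\<lambda>S. S - X"])
    show "(\<lambda>B. B \<union> X) ` {B. B \<subseteq> N - X \<and> card B = k - card X}
        \<subseteq> {S. S \<subseteq> N \<and> card S = k \<and> X \<subseteq> S}"
    proof safe
      fix B assume B: "B \<subseteq> N - X" "card B = k - card X"
      then have "card (B \<union> X) = card B + card X"
        using finX finite_subset[OF B(1)] assms(1) by (intro card_Un_disjoint) auto
      then show "card (B \<union> X) = k"
        using B assms(3) by simp
    qed (use assms in auto)
    show "(\<lambda>S. S - X) ` {S. S \<subseteq> N \<and> card S = k \<and> X \<subseteq> S}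
        \<subseteq> {B. B \<subseteq> N - X \<and> card B = k - card X}"
      using finX by (auto simp: card_Diff_subset)
  qed auto
  from bij_betw_same_card[OF this] show ?thesis
    using n_subsets[of "N - X" "k - card X"] assms finX by (simp add: card_Diff_subset)
qed

text \<open>The condition factors over the rows: row \<open>i\<close> must contain \<open>X\<close>,
  and each of the other \<open>L - 1\<close> rows must avoid it.\<close>

lemma card_private_supports:
  assumes "i < L" "X \<subseteq> {..<n}" "card X \<le> k"
  shows "card {f \<in> row_supports L n k. X \<subseteq> private_cols L f i} =
    ((n - card X) choose (k - card X)) * ((n - card X) choose k) ^ (L - 1)"
proof -
  let ?T = "{S. S \<subseteq> {..<n} \<and> card S = k \<and> X \<subseteq> S}"
  let ?V = "{S. S \<subseteq> {..<n} - X \<and> card S = k}"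
  have "{f \<in> row_supports L n k. X \<subseteq> private_cols L f i} =
      PiE {..<L} (\<lambda>l. if l = i then ?T else ?V)" (is "?A = ?B")
  proof
    show "?A \<subseteq> ?B"
    proof
      fix f assume f: "f \<in> ?A"
      then have "f l \<inter> X = {}" if "l < L" "l \<noteq> i" for l
        using that by (auto simp: private_cols_def)
      moreover have "X \<subseteq> f i"
        using f by (auto simp: private_cols_def)
      ultimately have "f l \<in> (if l = i then ?T else ?V)" if "l < L" for l
        using row_supportsD[of f L n k l] f that by auto
      then show "f \<in> ?B"
        using f by (auto simp: row_supports_def PiE_iff)
    qed
    show "?B \<subseteq> ?A"
    proof
      fix f assume f: "f \<in> ?B"
      have fT: "f i \<in> ?T"
        using PiE_mem[OF f, of i] assms(1) by simp
      have fV: "f l \<in> ?V" if "l < L" "l \<noteq> i" for l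
        using PiE_mem[OF f, of l] that by auto
      have "f l \<subseteq> {..<n} \<and> card (f l) = k" if "l < L" for l
        using fT fV[of l] that by (cases "l = i") auto
      moreover have "X \<subseteq> private_cols L f i"
        using fT fV unfolding private_cols_def by blast
      ultimately show "f \<in> ?A"
        using f by (auto simp: row_supports_def PiE_iff)
    qed
  qed
  then have "card {f \<in> row_supports L n k. X \<subseteq> private_cols L f i} =
      (\<Prod>l<L. card (if l = i then ?T else ?V))"
    by (simp add: card_PiE)
  also have "\<dots> = card ?T * (\<Prod>l\<in>{..<L} - {i}. card (if l = i then ?T else ?V))"
    using assms(1) by (subst prod.remove[of _ i]) auto
  also have "(\<Prod>l\<in>{..<L} - {i}. card (if l = i then ?T else ?V)) = card ?V ^ (L - 1)"
    using assms(1) by (subst prod.cong[OF refl, of _ _ "\<lambda>_. card ?V"]) auto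
  also have "card ?V = (n - card X) choose k"
    using assms(2) finite_subset[OF assms(2)] by (simp add: n_subsets card_Diff_subset)
  also have "card ?T = (n - card X) choose (k - card X)"
    using card_supersets[of "{..<n}" X k] assms by simp
  finally show ?thesis .
qed

text \<open>Binomial moments by double counting: pairs of a family \<open>f\<close> and an
  \<open>r\<close>-subset \<open>X\<close> of its private columns in row \<open>i\<close> are
  counted by \<open>X\<close> first.\<close>

lemma sum_choose_private_cols:
  assumes "i < L" "r \<le> k" "k \<le> n"
  shows "(\<Sum>f\<in>row_supports L n k. card (private_cols L f i) choose r) =
    (n choose k) * (k choose r) * ((n - r) choose k) ^ (L - 1)"
proof -
  let ?F = "row_supports L n k" and ?X = "{X. X \<subseteq> {..<n} \<and> card X = r}"
  have "card (private_cols L f i) choose r = (\<Sum>X\<in>?X. of_bool (X \<subseteq> private_cols L f i))"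
    if "f \<in> ?F" for f
  proof -
    have sub: "private_cols L f i \<subseteq> {..<n}"
      using row_supportsD(1)[OF that assms(1)] by (auto simp: private_cols_def)
    then have "{X. X \<subseteq> private_cols L f i \<and> card X = r} = ?X \<inter> {X. X \<subseteq> private_cols L f i}"
      by auto
    then show ?thesis
      using n_subsets[of "private_cols L f i" r] finite_subset[OF sub]
      by (simp add: of_bool_def sum.If_cases)
  qed
  then have "(\<Sum>f\<in>?F. card (private_cols L f i) choose r) =
      (\<Sum>f\<in>?F. \<Sum>X\<in>?X. of_bool (X \<subseteq> private_cols L f i))"
    by simp
  also have "\<dots> = (\<Sum>X\<in>?X. \<Sum>f\<in>?F. of_bool (X \<subseteq> private_cols L f i))"
    by (rule sum.swap)
  also have "\<dots> = (\<Sum>X\<in>?X. card {f \<in> ?F. X \<subseteq> private_cols L f i})"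
    by (simp add: of_bool_def sum.If_cases finite_row_supports Int_def)
  also have "\<dots> = (\<Sum>X\<in>?X. ((n - r) choose (k - r)) * ((n - r) choose k) ^ (L - 1))"
    using assms by (intro sum.cong refl) (auto simp: card_private_supports)
  also have "\<dots> = (n choose r) * ((n - r) choose (k - r)) * ((n - r) choose k) ^ (L - 1)"
    using n_subsets[of "{..<n}" r] by simp
  \<comment> \<open>\<open>choose_mult\<close> counts nested subsets in both orders and brings out
    the factor \<open>n choose k\<close>, which later cancels against the number of choices for row
    \<open>i\<close>.\<close>
  finally show ?thesis
    using choose_mult[OF assms(2,3)] by simp
qed

text \<open>Double counting by columns: column \<open>j\<close> is zero exactly if every row picks
  its support among the other \<open>n - 1\<close> columns.\<close>

lemma sum_card_zero_cols:
  "(\<Sum>f\<in>row_supports L n k. card (zero_cols L n f)) = n * ((n - 1) choose k) ^ L"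
proof -
  let ?F = "row_supports L n k"
  have "(\<Sum>f\<in>?F. card (zero_cols L n f)) = (\<Sum>f\<in>?F. \<Sum>j<n. of_bool (\<forall>i<L. j \<notin> f i))"
    by (intro sum.cong refl) (simp add: of_bool_def sum.If_cases zero_cols_def Int_def)
  also have "\<dots> = (\<Sum>j<n. \<Sum>f\<in>?F. of_bool (\<forall>i<L. j \<notin> f i))"
    by (rule sum.swap)
  also have "\<dots> = (\<Sum>j<n. card {f \<in> ?F. \<forall>i<L. j \<notin> f i})"
    by (simp add: of_bool_def sum.If_cases finite_row_supports Int_def)
  also have "\<dots> = (\<Sum>j<n. ((n - 1) choose k) ^ L)"
  proof (intro sum.cong refl)
    fix j assume j: "j \<in> {..<n}"
    have "{f \<in> ?F. \<forall>i<L. j \<notin> f i} = PiE {..<L} (\<lambda>_. {S. S \<subseteq> {..<n} - {j} \<and> card S = k})"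
      unfolding row_supports_def PiE_iff set_eq_iff mem_Collect_eq by blast
    then show "card {f \<in> ?F. \<forall>i<L. j \<notin> f i} = ((n - 1) choose k) ^ L"
      using j by (simp add: card_PiE n_subsets card_Diff_subset)
  qed
  finally show ?thesis by simp
qed

text \<open>The coefficients \<open>3\<close> and \<open>1\<close> in the bracket are
  \<open>3 choose 2\<close> and \<open>3 choose 3\<close> from the second and third binomial
  moments.\<close>

lemma sum_redundancy:
  assumes "3 \<le> n"
  shows "(\<Sum>f\<in>row_supports L n 3. real (redundancy L n f)) =
    n * real ((n - 1) choose 3) ^ L +
    L * real (n choose 3) *
      (3 * real ((n - 2) choose 3) ^ (L - 1) - real ((n - 3) choose 3) ^ (L - 1))"
proof -
  let ?F = "row_supports L n 3"
  \<comment> \<open>At \<open>u = 0\<close> this relies on truncated subtraction; it fails from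
    \<open>u = 4\<close> on, so three ones per row is essential here.\<close>
  have pred: "real (u - 1) = real (u choose 2) - real (u choose 3)" if "u \<le> 3" for u :: nat
  proof -
    have "u = 0 \<or> u = 1 \<or> u = 2 \<or> u = 3"
      using that by auto
    then show ?thesis by (auto simp: choose_two)
  qed
  have le3: "card (private_cols L f i) \<le> 3" if "f \<in> ?F" "i < L" for f i
    using card_mono[OF row_supportsD(3)[OF that], of "private_cols L f i"] row_supportsD(2)[OF that]
    by (auto simp: private_cols_def)
  have row: "(\<Sum>f\<in>?F. real (card (private_cols L f i) - 1)) =
      real (n choose 3) *
      (3 * real ((n - 2) choose 3) ^ (L - 1) - real ((n - 3) choose 3) ^ (L - 1))"
    if "i < L" for i
  proof -
    have "(\<Sum>f\<in>?F. real (card (private_cols L f i) - 1)) =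
      (\<Sum>f\<in>?F. real (card (private_cols L f i) choose 2) - real (card (private_cols L f i) choose 3))"
      using le3 that by (intro sum.cong refl pred) auto
    also have "\<dots> = real (\<Sum>f\<in>?F. card (private_cols L f i) choose 2) -
        real (\<Sum>f\<in>?F. card (private_cols L f i) choose 3)"
      by (simp add: sum_subtractf)
    finally show ?thesis
      unfolding sum_choose_private_cols[OF that _ assms, of 2, simplified]
        sum_choose_private_cols[OF that _ assms, of 3, simplified]
      by (simp add: choose_two algebra_simps)
  qed
  have "(\<Sum>f\<in>?F. real (redundancy L n f)) =
      real (\<Sum>f\<in>?F. card (zero_cols L n f)) +
      (\<Sum>f\<in>?F. \<Sum>i<L. real (card (private_cols L f i) - 1))"
    by (simp add: redundancy_def sum.distrib del: of_nat_diff)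
  also have "(\<Sum>f\<in>?F. \<Sum>i<L. real (card (private_cols L f i) - 1)) =
      (\<Sum>i<L. \<Sum>f\<in>?F. real (card (private_cols L f i) - 1))"
    by (rule sum.swap)
  finally show ?thesis
    by (simp add: row sum_card_zero_cols del: of_nat_diff One_nat_def)
qed

section \<open>The bound for fixed dimensions\<close>

text \<open>For \<open>r \<le> 3\<close>, \<open>q r\<close> is the probability that one random row
  avoids \<open>r\<close> given columns. The estimate arises by averaging \<open>bound\<close> over
  all families and dividing by \<open>L\<close>.\<close>

lemma max_rank_prob_le:
  assumes "3 \<le> n" "0 < L"
  defines "q \<equiv> \<lambda>r. real ((n - r) choose 3) / real (n choose 3)"
  shows "max_rank_prob L n \<le>
    1 - (1 - n / L + n / L * q 1 ^ L + 3 * q 2 ^ (L - 1) - q 3 ^ (L - 1))"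
proof -
  let ?F = "row_supports L n 3"
  let ?G = "{f \<in> ?F. vec_space.rank L (incidence_mat L n f) = L}"
  define N where "N = real (n choose 3)"
  have N: "N > 0"
    using assms(1) by (simp add: N_def zero_less_binomial_iff)
  have card_F: "real (card ?F) = N ^ L"
    by (simp add: card_row_supports N_def)
  \<comment> \<open>Full rank gives \<open>L + redundancy L n f \<le> n\<close>; without it,
    \<open>redundancy L n f \<le> n\<close> suffices.\<close>
  have bound: "real L - n + redundancy L n f \<le> (if f \<in> ?G then 0 else real L)" if f: "f \<in> ?F" for f
  proof -
    interpret vec_space "TYPE(bit)" L .
    have A: "incidence_mat L n f \<in> carrier_mat L n"
      by (simp add: incidence_mat_def)
    show ?thesis
      using rank_le_card_nonzero_cols[OF A] card_nonzero_cols_add_redundancy_le[OF f] f by auto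
  qed
  have "(real L - n) * N ^ L + (\<Sum>f\<in>?F. real (redundancy L n f)) =
      (\<Sum>f\<in>?F. real L - n + redundancy L n f)"
    using card_F by (simp add: sum.distrib)
  also have "\<dots> \<le> (\<Sum>f\<in>?F. if f \<in> ?G then 0 else real L)"
    by (intro sum_mono bound)
  also have "\<dots> = L * real (card (?F - ?G))"
  proof -
    have "?F \<inter> - {f. f \<in> ?G} = ?F - ?G" by auto
    then show ?thesis
      by (simp only: sum.If_cases[OF finite_row_supports]) simp
  qed
  also have "real (card (?F - ?G)) = N ^ L - card ?G"
    using card_F finite_row_supports[of L n 3] card_mono[of ?F ?G]
    by (simp add: card_Diff_subset of_nat_diff)
  also have "\<dots> = N ^ L * (1 - max_rank_prob L n)"
    using N by (simp add: max_rank_prob_eq[OF assms(1)] N_def field_simps)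
  finally have "((real L - n) * N ^ L + (\<Sum>f\<in>?F. real (redundancy L n f))) / (L * N ^ L)
      \<le> 1 - max_rank_prob L n"
    using N assms(2) by (simp add: divide_le_eq mult_ac)
  moreover have "((real L - n) * N ^ L + (\<Sum>f\<in>?F. real (redundancy L n f))) / (L * N ^ L) =
      1 - n / L + n / L * q 1 ^ L + 3 * q 2 ^ (L - 1) - q 3 ^ (L - 1)"
  proof -
    \<comment> \<open>In the private column terms one row contributes \<open>N\<close> itself and
      the others the power \<open>L - 1\<close>; splitting \<open>N ^ Suc m\<close> cancels that
      extra factor.\<close>
    obtain m where L: "L = Suc m"
      using assms(2) gr0_implies_Suc by blast
    show ?thesis
      using N unfolding sum_redundancy[OF assms(1)] q_def N_def[symmetric] L
      by (simp add: power_divide add_divide_distrib diff_divide_distrib ring_distribs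
          del: of_nat_Suc of_nat_diff)
  qed
  ultimately show ?thesis by simp
qed

section \<open>Passage to the limit\<close>

lemma choose_3_real: "real (m choose 3) = real m * (real m - 1) * (real m - 2) / 6"
proof (induction m)
  case (Suc m)
  have "Suc m choose 3 = (m choose 2) + (m choose 3)"
    by (simp add: numeral_3_eq_3 numeral_2_eq_2)
  moreover have "real (m choose 2) = real m * (real m - 1) / 2"
    by (cases m) (auto simp: choose_two real_of_nat_div field_simps)
  ultimately show ?case
    using Suc by (simp add: field_simps)
qed simp

text \<open>The ratio of the two cubics is \<open>1 - 3 * r / n\<close> up to order
  \<open>1 / n^2\<close>, so \<open>n\<close> times its logarithm tends to \<open>- 3 * r\<close>;
  the exponent \<open>l n\<close> is then written as \<open>(l n / n) * n\<close>.\<close>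

lemma choose_ratio_power_tendsto:
  fixes l :: "nat \<Rightarrow> nat" and c :: real
  assumes "r \<in> {1, 2, 3}" and l: "(\<lambda>n. real (l n) / real n) \<longlonglongrightarrow> c"
  shows "(\<lambda>n. (real ((n - r) choose 3) / real (n choose 3)) ^ l n) \<longlonglongrightarrow> exp (- 3 * real r * c)"
proof -
  define h where "h = (\<lambda>x::real. (x - r) * (x - r - 1) * (x - r - 2) / (x * (x - 1) * (x - 2)))"
  have "(\<lambda>n. real n * ln (h (real n))) \<longlonglongrightarrow> - 3 * real r"
  proof -
    have "r = 1 \<or> r = 2 \<or> r = 3"
      using assms(1) by auto
    then show ?thesis
    proof (elim disjE)
      assume "r = 1"
      show ?thesis unfolding h_def \<open>r = 1\<close> of_nat_1 by real_asymp
    next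
      assume "r = 2"
      show ?thesis unfolding h_def \<open>r = 2\<close> of_nat_numeral by real_asymp
    next
      assume "r = 3"
      show ?thesis unfolding h_def \<open>r = 3\<close> of_nat_numeral by real_asymp
    qed
  qed
  then have "(\<lambda>n. exp ((real (l n) / real n) * (real n * ln (h (real n)))))
      \<longlonglongrightarrow> exp (c * (- 3 * real r))"
    by (rule tendsto_exp[OF tendsto_mult[OF l]])
  moreover have "\<forall>\<^sub>F n in sequentially. exp ((real (l n) / real n) * (real n * ln (h (real n)))) =
      (real ((n - r) choose 3) / real (n choose 3)) ^ l n"
    \<comment> \<open>Any threshold that keeps \<open>n - r - 2\<close> positive for
      \<open>r \<le> 3\<close> would do, since then all factors of \<open>h\<close> are
      positive.\<close>
    using eventually_gt_at_top[of 10]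
  proof eventually_elim
    case (elim n)
    have r: "r \<le> 3" using assms(1) by auto
    have "real ((n - r) choose 3) / real (n choose 3) = h (real n)"
      using elim r by (simp add: choose_3_real h_def of_nat_diff)
    moreover have "h (real n) > 0"
      using elim r unfolding h_def by (intro divide_pos_pos mult_pos_pos) auto
    ultimately show ?case
      using elim by (simp add: exp_of_nat_mult)
  qed
  ultimately show ?thesis
    by (simp add: tendsto_cong mult_ac)
qed

theorem theorem4:
  fixes c :: real and L :: "nat \<Rightarrow> nat"
  assumes "0 < c" and "c \<le> 1"
    and "\<And>n. L n = nat \<lfloor>c * real n\<rfloor> \<or> L n = nat \<lceil>c * real n\<rceil>"
  shows "\<exists>\<epsilon> :: nat \<Rightarrow> real. \<epsilon> \<longlonglongrightarrow> 0 \<and>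
    (\<forall>n\<ge>3. max_rank_prob (L n) n
       \<le> 1 - (exp (- 3 * c) + 3 * c * exp (- 6 * c) - c * exp (- 9 * c) - 1 + c) / c + \<epsilon> n)"
proof -
  define E where "E = (exp (- 3 * c) + 3 * c * exp (- 6 * c) - c * exp (- 9 * c) - 1 + c) / c"
  define q where "q = (\<lambda>n r. real ((n - r) choose 3) / real (n choose 3))"
  \<comment> \<open>The lower bound of \<open>max_rank_prob_le\<close> for the probability of
    deficient rank; its limit is \<open>E\<close>.\<close>
  define b where "b = (\<lambda>n. 1 - real n / L n + real n / L n * q n 1 ^ L n
      + 3 * q n 2 ^ (L n - 1) - q n 3 ^ (L n - 1))"
  \<comment> \<open>Taking the positive part of the excess makes the inequality hold for every
    \<open>n\<close> at once, so only the convergence of \<open>\<epsilon>\<close> remains.\<close>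
  define \<epsilon> where "\<epsilon> = (\<lambda>n. max 0 (max_rank_prob (L n) n - (1 - E)))"
  have L_bounds: "c * n - 1 \<le> L n" "L n \<le> c * n + 1" for n
  proof -
    have "c * n \<ge> 0" using assms(1) by simp
    then show "c * n - 1 \<le> L n" "L n \<le> c * n + 1"
      using assms(3)[of n] by (auto simp: of_nat_nat) linarith+
  qed
  have lim0: "(\<lambda>n. c - 1 / real n) \<longlonglongrightarrow> c" "(\<lambda>n. c + 1 / real n) \<longlonglongrightarrow> c"
    by real_asymp+
  have limL: "(\<lambda>n. real (L n) / real n) \<longlonglongrightarrow> c"
  proof (rule tendsto_sandwich[OF _ _ lim0(1,2)])
    show "\<forall>\<^sub>F n in sequentially. c - 1 / real n \<le> real (L n) / real n"
      using eventually_gt_at_top[of 0]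
      proof eventually_elim
        case (elim n)
        then show ?case
          using divide_right_mono[OF L_bounds(1)[of n], of "real n"] by (simp add: diff_divide_distrib)
      qed
    show "\<forall>\<^sub>F n in sequentially. real (L n) / real n \<le> c + 1 / real n"
      using eventually_gt_at_top[of 0]
      proof eventually_elim
        case (elim n)
        then show ?case
          using divide_right_mono[OF L_bounds(2)[of n], of "real n"] by (simp add: add_divide_distrib)
      qed
  qed
  \<comment> \<open>Rounding down may give \<open>L n = 0\<close> for small \<open>n\<close>, where
    \<open>max_rank_prob_le\<close> does not apply.\<close>
  have L_pos: "\<forall>\<^sub>F n in sequentially. 0 < L n"
  proof -
    have "\<forall>\<^sub>F n in sequentially. 0 < real (L n) / real n"
      using limL assms(1) by (rule order_tendstoD)
    then show ?thesis
      by eventually_elim (auto simp: zero_less_divide_iff)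
  qed
  have limL1: "(\<lambda>n. real (L n - 1) / real n) \<longlonglongrightarrow> c"
  proof -
    have "(\<lambda>n. real (L n) / real n - 1 / real n) \<longlonglongrightarrow> c - 0"
      by (intro tendsto_diff limL) real_asymp
    moreover have "\<forall>\<^sub>F n in sequentially.
        real (L n) / real n - 1 / real n = real (L n - 1) / real n"
      using L_pos by eventually_elim (simp add: of_nat_diff diff_divide_distrib)
    ultimately show ?thesis
      by (simp add: tendsto_cong)
  qed
  have limn: "(\<lambda>n. real n / L n) \<longlonglongrightarrow> 1 / c"
    using tendsto_divide[OF tendsto_const[of 1] limL] assms(1) by simp
  have "b \<longlonglongrightarrow> 1 - 1 / c + 1 / c * exp (- 3 * real 1 * c)
      + 3 * exp (- 3 * real 2 * c) - exp (- 3 * real 3 * c)"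
    unfolding b_def q_def
    by (intro tendsto_intros limn choose_ratio_power_tendsto limL limL1) auto
  also have "1 - 1 / c + 1 / c * exp (- 3 * real 1 * c)
      + 3 * exp (- 3 * real 2 * c) - exp (- 3 * real 3 * c) = E"
    using assms(1) by (simp add: E_def field_simps)
  finally have "(\<lambda>n. max 0 (E - b n)) \<longlonglongrightarrow> max 0 (E - E)"
    by (intro tendsto_intros)
  then have lim: "(\<lambda>n. max 0 (E - b n)) \<longlonglongrightarrow> 0"
    by simp
  \<comment> \<open>Once the probability is at most \<open>1 - b n\<close>, its excess over
    \<open>1 - E\<close> is at most \<open>E - b n\<close>, which squeezes \<open>\<epsilon>\<close>
    to \<open>0\<close>.\<close>
  have "\<forall>\<^sub>F n in sequentially. \<epsilon> n \<le> max 0 (E - b n)"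
    using L_pos eventually_ge_at_top[of 3]
  proof eventually_elim
    case (elim n)
    have "max_rank_prob (L n) n \<le> 1 - b n"
      unfolding b_def q_def using elim(2,1) by (rule max_rank_prob_le)
    then show ?case
      unfolding \<epsilon>_def by linarith
  qed
  then have "\<epsilon> \<longlonglongrightarrow> 0"
    by (intro tendsto_sandwich[OF _ _ tendsto_const lim]) (auto simp: \<epsilon>_def)
  then show ?thesis
    by (intro exI[of _ \<epsilon>]) (auto simp: \<epsilon>_def E_def)
qed

end
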